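(* Let $r\geq 3$ and let $F$ be a family of graphs with Turán density $\pi(F)=1-1/r$. Let $\varepsilon,\sigma$ be real numbers with $0<\varepsilon<1/2$ and $\sigma<\varepsilon/36$. For each $n$ let $\mathcal{G}_n$ be the collection of all $n$-vertex $F$-free graphs with minimum degree more than $(\pi(F)-\varepsilon)n$, and denote $q(\mathcal{G}_n)=\max\{q(G): G\in\mathcal{G}_n\}$. Suppose that there exists $N>0$ such that for every $n\geq N$, \[ \big|\mathrm{ex}(n,F)-\mathrm{ex}(n-1,F)-\pi(F)n\big|\leq \sigma n \] and \[ \big|q(\mathcal{G}_n)-4\,\mathrm{ex}(n,F)n^{-1}\big|\leq \sigma. \] Then there exists $n_0\in\mathbb{N}$ such that for any $F$-free graph $H$ on $n\geq n_0$ vertices, \[ q(H)\leq q(\mathcal{G}_n). \] In addition, if equality holds, then $H\in\mathcal{G}_n$.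
   Context: All graphs are finite and simple. For a family $F$ of graphs, a graph is $F$-free if it contains no subgraph (not necessarily induced) isomorphic to a member of $F$. The Turán number $\mathrm{ex}(n,F)$ is the maximum number of edges of an $F$-free graph on $n$ vertices, and the Turán density is $\pi(F)=\lim_{n\to\infty}\mathrm{ex}(n,F)/\binom{n}{2}$ (the limit exists). The signless Laplacian matrix of a graph $G$ is $Q(G)=D(G)+A(G)$, where $D(G)$ is the diagonal matrix of vertex degrees and $A(G)$ is the adjacency matrix; $q(G)$ is the maximum modulus of the eigenvalues of $Q(G)$. The hypothesis involving $q(\mathcal{G}_n)$ presupposes that $\mathcal{G}_n$ is nonempty for $n\geq N$, so that the maximum is defined. *)

theory Defs
  imports Complex_Main "Jordan_Normal_Form.Spectral_Radius"
begin

text \<open>A graph is a pair of a vertex set and a set of edges, an edge being a 2-element set of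
  vertices. Vertices are natural numbers and the vertex set is an arbitrary finite set, so that
  every finite simple graph occurs up to isomorphism.\<close>

type_synonym graph = "nat set \<times> nat set set"

abbreviation verts :: "graph \<Rightarrow> nat set" where "verts G \<equiv> fst G"
abbreviation edges :: "graph \<Rightarrow> nat set set" where "edges G \<equiv> snd G"

definition simple_graph :: "graph \<Rightarrow> bool" where
  "simple_graph G \<longleftrightarrow> finite (verts G) \<and> (\<forall>e\<in>edges G. e \<subseteq> verts G \<and> card e = 2)"

definition subgraph_of :: "graph \<Rightarrow> graph \<Rightarrow> bool" where
  "subgraph_of S G \<longleftrightarrow> simple_graph S \<and> verts S \<subseteq> verts G \<and> edges S \<subseteq> edges G"

definition graph_isomorphic :: "graph \<Rightarrow> graph \<Rightarrow> bool" where
  "graph_isomorphic G K \<longleftrightarrow>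
     (\<exists>f. bij_betw f (verts G) (verts K) \<and> (\<lambda>e. f ` e) ` edges G = edges K)"

definition F_free :: "graph set \<Rightarrow> graph \<Rightarrow> bool" where
  "F_free F G \<longleftrightarrow> \<not> (\<exists>K\<in>F. \<exists>S. subgraph_of S G \<and> graph_isomorphic S K)"

text \<open>The set below is finite, but it is empty if some member of \<open>F\<close> has no edges and at most
  \<open>n\<close> vertices; then \<open>Max\<close> is an unspecified constant, and the density below is 0.\<close>

definition ex_num :: "nat \<Rightarrow> graph set \<Rightarrow> nat" where
  "ex_num n F = Max {card (edges G) |G. simple_graph G \<and> card (verts G) = n \<and> F_free F G}"

definition turan_density :: "graph set \<Rightarrow> real" where
  "turan_density F = lim (\<lambda>n. real (ex_num n F) / real (n choose 2))"

definition vdegree :: "graph \<Rightarrow> nat \<Rightarrow> nat" where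
  "vdegree G v = card {e \<in> edges G. v \<in> e}"

definition min_degree :: "graph \<Rightarrow> nat" where
  "min_degree G = Min (vdegree G ` verts G)"

text \<open>Rows and columns of the matrices of \<open>G\<close> are indexed by \<open>0, \<dots>, card (verts G) - 1\<close>, which
  enumerate the vertices in increasing order.\<close>

definition vert :: "graph \<Rightarrow> nat \<Rightarrow> nat" where
  "vert G i = sorted_list_of_set (verts G) ! i"

definition adjacency_mat :: "graph \<Rightarrow> complex mat" where
  "adjacency_mat G = mat (card (verts G)) (card (verts G))
     (\<lambda>(i, j). if {vert G i, vert G j} \<in> edges G then 1 else 0)"

definition degree_mat :: "graph \<Rightarrow> complex mat" where
  "degree_mat G = mat (card (verts G)) (card (verts G))
     (\<lambda>(i, j). if i = j then of_nat (vdegree G (vert G i)) else 0)"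

definition signless_laplacian :: "graph \<Rightarrow> complex mat" where
  "signless_laplacian G = degree_mat G + adjacency_mat G"

definition q_radius :: "graph \<Rightarrow> real" where
  "q_radius G = spectral_radius (signless_laplacian G)"

definition G_family :: "graph set \<Rightarrow> real \<Rightarrow> nat \<Rightarrow> graph set" where
  "G_family F \<epsilon> n = {G. simple_graph G \<and> card (verts G) = n \<and> F_free F G \<and>
     real (min_degree G) > (turan_density F - \<epsilon>) * real n}"

text \<open>There are infinitely many graphs on \<open>n\<close> vertices, but only finitely many values of
  \<open>q_radius\<close> on them, so this is a maximum whenever the family is nonempty and \<open>n > 0\<close>.\<close>

definition q_max :: "graph set \<Rightarrow> real \<Rightarrow> nat \<Rightarrow> real" where
  "q_max F \<epsilon> n = Max (q_radius ` G_family F \<epsilon> n)"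

end

theory Submission
  imports Defs "HOL-Analysis.Convex"
begin

text \<open>Write \<open>p\<close> for the Turan density and call an \<open>F\<close>-free graph exceptional if it lies outside the
  family of graphs of large minimum degree but its radius \<open>q\<close> is at least the maximum over that
  family. The theorem says that large exceptional graphs do not exist. An exceptional graph on \<open>m\<close>
  vertices contains one on \<open>m - 1\<close> vertices (\<open>exceptional_descends\<close>), and \<open>q / (m - 1)\<close>, which never
  exceeds 2, increases by at least a constant multiple of \<open>1 / m\<close> in the step. The descent can be
  repeated down to a fixed number \<open>M\<close> of vertices, so the divergence of the harmonic series bounds
  the number of vertices at its start.

  The vertex to delete is the one with the smallest entry in a unit eigenvector \<open>f\<close> for \<open>q\<close>. If
  all entries were equal, the restriction of \<open>f\<close> would lose about \<open>q / m\<close>, that is \<open>2 * p\<close> when \<open>q\<close> is close to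
  \<open>2 * p * m\<close>; this is just the drop of the maximum over the family. A vertex of degree at most
  \<open>(p - \<epsilon>) * m\<close> forces an entry whose square is below the average \<open>1 / m\<close> by a factor
  \<open>1 - 7 / 5 * \<epsilon>\<close> (\<open>delete_light_vertex\<close>, \<open>light_vertex_entry_bound\<close>), and deleting a vertex with such
  an entry costs less by \<open>7 / 5 * \<epsilon> * (q / m - 1)\<close> (\<open>deletion_decrement\<close>). Here \<open>r \<ge> 3\<close> enters: it
  keeps \<open>q / m\<close> away from 1. The saving beats the errors of size \<open>\<sigma>\<close> in the hypotheses
  (\<open>excess_survives_deletion\<close>).

  The test-vector argument rests on the Rayleigh principle for the spectral radius of a real
  symmetric matrix (\<open>quadratic_form_le_spectral_radius\<close>).\<close>

section \<open>Rayleigh quotients of real symmetric matrices\<close>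

definition real_mat :: "nat \<Rightarrow> (nat \<Rightarrow> nat \<Rightarrow> real) \<Rightarrow> complex mat" where
  "real_mat n a = mat n n (\<lambda>(i, j). complex_of_real (a i j))"

lemma real_mat_carrier [simp]: "real_mat n a \<in> carrier_mat n n"
  by (simp add: real_mat_def)

lemma real_mat_mult_vec:
  assumes "v \<in> carrier_vec n" "i < n"
  shows "(real_mat n a *\<^sub>v v) $ i = (\<Sum>j<n. complex_of_real (a i j) * v $ j)"
  using assms
  by (simp add: real_mat_def index_mult_mat_vec scalar_prod_def lessThan_atLeast0)

text \<open>Write \<open>T\<close> for the operator given by \<open>a\<close> and suppose that \<open>x\<close> violates the inequality.
  Then \<open>T x\<close> is longer than \<open>x\<close>. Since \<open>T\<close> is self-adjoint, Cauchy-Schwarz makes the squared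
  lengths of the iterates \<open>T\<^sup>k x\<close> log-convex in \<open>k\<close>, so they grow geometrically. But the powers of
  a matrix of spectral radius less than 1 are bounded.\<close>

lemma quadratic_form_le_if_spectral_radius_less_1:
  assumes sym: "\<And>i j. i < n \<Longrightarrow> j < n \<Longrightarrow> a i j = a j i"
    and sr: "spectral_radius (real_mat n a) < 1"
  shows "(\<Sum>i<n. x i * (\<Sum>j<n. a i j * x j)) \<le> (\<Sum>i<n. (x i)\<^sup>2)"
proof (rule ccontr)
  define T where "T = (\<lambda>y i. \<Sum>j<n. a i j * y j)"
  define y where "y k = (T ^^ k) x" for k
  define S where "S k = (\<Sum>i<n. (y k i)\<^sup>2)" for k
  assume "\<not> ?thesis"
  then have gt: "(\<Sum>i<n. y 0 i * y 1 i) > S 0"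
    by (simp add: y_def S_def T_def)
  have y_Suc: "y (Suc k) i = (\<Sum>j<n. a i j * y k j)" for k i
    by (simp add: y_def T_def)
  have self_adjoint: "(\<Sum>i<n. f i * T g i) = (\<Sum>i<n. T f i * g i)" for f g
  proof -
    have "(\<Sum>i<n. f i * T g i) = (\<Sum>i<n. \<Sum>j<n. f i * (a i j * g j))"
      by (simp add: T_def sum_distrib_left)
    also have "\<dots> = (\<Sum>j<n. \<Sum>i<n. f i * (a i j * g j))"
      by (rule sum.swap)
    also have "\<dots> = (\<Sum>j<n. \<Sum>i<n. a j i * f i * g j)"
      by (intro sum.cong refl) (use sym in auto)
    also have "\<dots> = (\<Sum>i<n. T f i * g i)"
      by (simp add: T_def sum_distrib_right)
    finally show ?thesis .
  qed
  have S_nonneg: "S k \<ge> 0" for k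
    by (simp add: S_def sum_nonneg)
  have log_convex: "(S (Suc k))\<^sup>2 \<le> S k * S (Suc (Suc k))" for k
  proof -
    have "S (Suc k) = (\<Sum>i<n. T (y k) i * y (Suc k) i)"
      by (simp add: S_def power2_eq_square y_def)
    also have "\<dots> = (\<Sum>i<n. y k i * y (Suc (Suc k)) i)"
      using self_adjoint[of "y k" "y (Suc k)"] by (simp add: y_def)
    finally show ?thesis
      using Cauchy_Schwarz_ineq_sum[of "y k" "y (Suc (Suc k))" "{..<n}"] by (simp add: S_def)
  qed
  have CS01: "(\<Sum>i<n. y 0 i * y 1 i)\<^sup>2 \<le> S 0 * S 1"
    using Cauchy_Schwarz_ineq_sum[of "y 0" "y 1" "{..<n}"] by (simp add: S_def)
  have "S 0 > 0"
  proof (rule ccontr)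
    assume "\<not> S 0 > 0"
    with S_nonneg[of 0] have "S 0 = 0" by simp
    with CS01 have "(\<Sum>i<n. y 0 i * y 1 i) = 0" by simp
    with gt \<open>S 0 = 0\<close> show False by simp
  qed
  define s where "s = S 1 / S 0"
  have "(S 0)\<^sup>2 < (\<Sum>i<n. y 0 i * y 1 i)\<^sup>2"
    using gt \<open>S 0 > 0\<close> by (intro power_strict_mono) auto
  with CS01 have "S 0 * S 0 < S 0 * S 1" by (simp add: power2_eq_square)
  then have "S 0 < S 1" using \<open>S 0 > 0\<close> by simp
  then have "s > 1" using \<open>S 0 > 0\<close> by (simp add: s_def)
  have growth: "S k > 0 \<and> S (Suc k) \<ge> s * S k" for k
  proof (induction k)
    case 0
    then show ?case using \<open>S 0 > 0\<close> by (simp add: s_def)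
  next
    case (Suc k)
    have pos: "S (Suc k) > 0"
      using Suc \<open>s > 1\<close> by (smt (verit) mult_pos_pos)
    have "S k * (s * S (Suc k)) \<le> S (Suc k) * S (Suc k)"
      using Suc pos mult_right_mono[of "s * S k" "S (Suc k)" "S (Suc k)"] by (simp add: ac_simps)
    also have "\<dots> \<le> S k * S (Suc (Suc k))"
      using log_convex[of k] by (simp add: power2_eq_square)
    finally have "s * S (Suc k) \<le> S (Suc (Suc k))" using Suc by simp
    with pos show ?case by simp
  qed
  have lower: "S k \<ge> s ^ k * S 0" for k
  proof (induction k)
    case (Suc k)
    have "s ^ Suc k * S 0 = s * (s ^ k * S 0)" by simp
    also have "\<dots> \<le> s * S k" using Suc \<open>s > 1\<close> by simp
    also have "\<dots> \<le> S (Suc k)" using growth by simp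
    finally show ?case .
  qed simp
  let ?M = "real_mat n a"
  let ?v = "vec n (\<lambda>i. complex_of_real (x i))"
  have pow_carrier: "?M ^\<^sub>m k \<in> carrier_mat n n" for k
    by simp
  have commute: "?M * ?M ^\<^sub>m k = ?M ^\<^sub>m k * ?M" for k
  proof (induction k)
    case 0
    show ?case by (simp add: real_mat_def)
  next
    case (Suc k)
    then show ?case
      by (simp add: assoc_mult_mat[OF real_mat_carrier pow_carrier real_mat_carrier, symmetric])
  qed
  have powers: "?M ^\<^sub>m k *\<^sub>v ?v = vec n (\<lambda>i. complex_of_real (y k i))" for k
  proof (induction k)
    case 0
    show ?case by (simp add: y_def real_mat_def)
  next
    case (Suc k)
    have "?M ^\<^sub>m Suc k *\<^sub>v ?v = ?M *\<^sub>v (?M ^\<^sub>m k *\<^sub>v ?v)"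
      by (simp add: commute[symmetric] assoc_mult_mat_vec[OF real_mat_carrier pow_carrier])
    also have "\<dots> = vec n (\<lambda>i. complex_of_real (y (Suc k) i))"
    proof (rule eq_vecI)
      fix i assume "i < dim_vec (vec n (\<lambda>i. complex_of_real (y (Suc k) i)))"
      then have i: "i < n" by simp
      show "(?M *\<^sub>v (?M ^\<^sub>m k *\<^sub>v ?v)) $ i = vec n (\<lambda>i. complex_of_real (y (Suc k) i)) $ i"
        unfolding Suc real_mat_mult_vec[OF vec_carrier i] using i by (simp add: y_Suc)
    qed (simp add: real_mat_def)
    finally show ?case .
  qed
  obtain c where c: "\<And>k. norm_bound (?M ^\<^sub>m k) c"
    using spectral_radius_jnf_norm_bound_less_1_upper_triangular[OF real_mat_carrier sr] by blast
  define C where "C = (\<Sum>j<n. \<bar>c\<bar> * \<bar>x j\<bar>)"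
  have y_bound: "\<bar>y k i\<bar> \<le> C" if "i < n" for k i
  proof -
    have dims: "dim_row (?M ^\<^sub>m k) = n" "dim_col (?M ^\<^sub>m k) = n"
      using pow_carrier[of k] by (blast dest: carrier_matD)+
    have "complex_of_real (y k i) = (?M ^\<^sub>m k *\<^sub>v ?v) $ i"
      using that by (simp add: powers)
    also have "\<dots> = (\<Sum>j<n. (?M ^\<^sub>m k) $$ (i, j) * complex_of_real (x j))"
      using that dims by (simp add: scalar_prod_def lessThan_atLeast0)
    finally have "\<bar>y k i\<bar> = norm (\<Sum>j<n. (?M ^\<^sub>m k) $$ (i, j) * complex_of_real (x j))"
      by (metis norm_of_real)
    also have "\<dots> \<le> (\<Sum>j<n. norm ((?M ^\<^sub>m k) $$ (i, j) * complex_of_real (x j)))"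
      by (rule norm_sum)
    also have "\<dots> \<le> C" unfolding C_def norm_mult
    proof (intro sum_mono mult_mono)
      fix j assume "j \<in> {..<n}"
      then show "norm ((?M ^\<^sub>m k) $$ (i, j)) \<le> \<bar>c\<bar>"
        using c[of k] dims that by (force simp: norm_bound_def)
    qed auto
    finally show ?thesis .
  qed
  have upper: "S k \<le> real n * C\<^sup>2" for k
  proof -
    have "S k \<le> (\<Sum>i<n. C\<^sup>2)" unfolding S_def
    proof (rule sum_mono)
      fix i assume "i \<in> {..<n}"
      then have "\<bar>y k i\<bar>\<^sup>2 \<le> C\<^sup>2" by (intro power_mono y_bound) auto
      then show "(y k i)\<^sup>2 \<le> C\<^sup>2" by simp
    qed
    then show ?thesis by simp
  qed
  obtain k where "real n * C\<^sup>2 / S 0 < s ^ k"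
    using real_arch_pow[OF \<open>s > 1\<close>] by blast
  then have "real n * C\<^sup>2 < s ^ k * S 0" using \<open>S 0 > 0\<close> by (simp add: field_simps)
  with lower[of k] upper[of k] show False by simp
qed

lemma spectral_radius_real_mat_nonneg:
  assumes "n > 0" shows "spectral_radius (real_mat n a) \<ge> 0"
  using spectral_radius_mem_max(1)[OF real_mat_carrier assms, of a]
  by (metis imageE norm_ge_zero)

text \<open>The Rayleigh principle.\<close>

text \<open>The Rayleigh principle, from the previous lemma applied to \<open>a / t\<close> for each \<open>t\<close> above the
  spectral radius.\<close>

lemma quadratic_form_le_spectral_radius:
  assumes sym: "\<And>i j. i < n \<Longrightarrow> j < n \<Longrightarrow> a i j = a j i" and n: "n > 0"
  shows "(\<Sum>i<n. x i * (\<Sum>j<n. a i j * x j))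
           \<le> spectral_radius (real_mat n a) * (\<Sum>i<n. (x i)\<^sup>2)"
proof -
  let ?\<rho> = "spectral_radius (real_mat n a)"
  let ?B = "\<Sum>i<n. x i * (\<Sum>j<n. a i j * x j)"
  let ?X = "\<Sum>i<n. (x i)\<^sup>2"
  have scaled: "?B \<le> t * ?X" if t: "t > ?\<rho>" for t
  proof -
    have "t > 0" using t spectral_radius_real_mat_nonneg[OF n, of a] by simp
    let ?b = "\<lambda>i j. a i j / t"
    have "spectral_radius (real_mat n ?b) \<in> norm ` spectrum (real_mat n ?b)"
      by (rule spectral_radius_mem_max(1)[OF real_mat_carrier n])
    then obtain l v where l: "spectral_radius (real_mat n ?b) = norm l"
      and v: "eigenvector (real_mat n ?b) v l"
      by (auto simp: spectrum_def eigenvalue_def)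
    from v have v: "v \<in> carrier_vec n" "v \<noteq> 0\<^sub>v n" "real_mat n ?b *\<^sub>v v = l \<cdot>\<^sub>v v"
      by (auto simp: eigenvector_def real_mat_def)
    have "real_mat n a *\<^sub>v v = (complex_of_real t * l) \<cdot>\<^sub>v v"
    proof (rule eq_vecI)
      fix i assume "i < dim_vec ((complex_of_real t * l) \<cdot>\<^sub>v v)"
      then have i: "i < n" using v by auto
      have "(real_mat n a *\<^sub>v v) $ i = complex_of_real t * (real_mat n ?b *\<^sub>v v) $ i"
        unfolding real_mat_mult_vec[OF v(1) i] using \<open>t > 0\<close>
        by (simp add: sum_distrib_left)
      also have "\<dots> = ((complex_of_real t * l) \<cdot>\<^sub>v v) $ i"
        using i v by (simp add: v(3))
      finally show "(real_mat n a *\<^sub>v v) $ i = ((complex_of_real t * l) \<cdot>\<^sub>v v) $ i" .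
    qed (use v in \<open>auto simp: real_mat_def\<close>)
    then have "complex_of_real t * l \<in> spectrum (real_mat n a)"
      using v by (auto simp: spectrum_def eigenvalue_def eigenvector_def real_mat_def)
    then have "norm (complex_of_real t * l) \<le> ?\<rho>"
      by (intro spectral_radius_mem_max(2)[OF real_mat_carrier n]) auto
    then have "t * norm l \<le> ?\<rho>" using \<open>t > 0\<close> by (simp add: norm_mult)
    then have "t * norm l < t * 1" using t by simp
    then have "norm l < 1" using \<open>t > 0\<close> by (simp only: mult_less_cancel_left_pos)
    then have "(\<Sum>i<n. x i * (\<Sum>j<n. ?b i j * x j)) \<le> ?X"
      using sym l by (intro quadratic_form_le_if_spectral_radius_less_1) auto
    moreover have "(\<Sum>i<n. x i * (\<Sum>j<n. ?b i j * x j)) = ?B / t"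
      by (simp add: sum_divide_distrib[symmetric])
    ultimately have "?B / t \<le> ?X" by (simp only:)
    then show ?thesis
      using pos_divide_le_eq[OF \<open>t > 0\<close>, of ?B ?X] by (simp only: mult.commute[of t])
  qed
  have "?B \<le> ?\<rho> * ?X + e" if "e > 0" for e
  proof -
    have X: "?X \<ge> 0" by (simp add: sum_nonneg)
    have "?B \<le> (?\<rho> + e / (?X + 1)) * ?X"
      using X that by (intro scaled) simp
    also have "\<dots> = ?\<rho> * ?X + e * (?X / (?X + 1))" by (simp add: algebra_simps)
    also have "\<dots> \<le> ?\<rho> * ?X + e * 1"
      using X that by (intro add_left_mono mult_left_mono) auto
    finally show ?thesis by simp
  qed
  then show ?thesis by (rule field_le_epsilon)
qed

text \<open>An eigenvalue of maximum modulus is real because the matrix is symmetric, and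
  nonnegative because the form is, so it is the spectral radius itself. The real or the imaginary
  part of a complex eigenvector is then a real one.\<close>

lemma spectral_radius_real_eigenvector:
  assumes sym: "\<And>i j. i < n \<Longrightarrow> j < n \<Longrightarrow> a i j = a j i" and n: "n > 0"
    and psd: "\<And>x. (\<Sum>i<n. x i * (\<Sum>j<n. a i j * x j)) \<ge> 0"
  obtains x where "\<exists>i<n. x i \<noteq> 0"
    and "\<And>i. i < n \<Longrightarrow> (\<Sum>j<n. a i j * x j) = spectral_radius (real_mat n a) * x i"
proof -
  let ?\<rho> = "spectral_radius (real_mat n a)"
  have "?\<rho> \<in> norm ` spectrum (real_mat n a)"
    by (rule spectral_radius_mem_max(1)[OF real_mat_carrier n])
  then obtain l v where l: "?\<rho> = norm l" and v: "eigenvector (real_mat n a) v l"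
    by (auto simp: spectrum_def eigenvalue_def)
  from v have v: "v \<in> carrier_vec n" "v \<noteq> 0\<^sub>v n" "real_mat n a *\<^sub>v v = l \<cdot>\<^sub>v v"
    by (auto simp: eigenvector_def real_mat_def)
  have eig: "(\<Sum>j<n. complex_of_real (a i j) * v $ j) = l * v $ i" if "i < n" for i
  proof -
    have "(\<Sum>j<n. complex_of_real (a i j) * v $ j) = (real_mat n a *\<^sub>v v) $ i"
      using real_mat_mult_vec[OF v(1) that] by simp
    also have "\<dots> = l * v $ i" using v(1) that by (simp add: v(3))
    finally show ?thesis .
  qed
  define p where "p i = Re (v $ i)" for i
  define q where "q i = Im (v $ i)" for i
  define P where "P = (\<Sum>i<n. (p i)\<^sup>2)"
  define Q where "Q = (\<Sum>i<n. (q i)\<^sup>2)"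
  have re: "(\<Sum>j<n. a i j * p j) = Re l * p i - Im l * q i"
    and im: "(\<Sum>j<n. a i j * q j) = Re l * q i + Im l * p i" if "i < n" for i
    using arg_cong[OF eig[OF that], of Re] arg_cong[OF eig[OF that], of Im]
    by (simp_all add: p_def q_def)
  obtain i0 where i0: "i0 < n" "v $ i0 \<noteq> 0"
    using v(1,2) by (metis carrier_vecD eq_vecI index_zero_vec)
  then have "p i0 \<noteq> 0 \<or> q i0 \<noteq> 0" by (auto simp: p_def q_def complex_eq_iff)
  then have PQ: "P + Q > 0"
  proof
    assume "p i0 \<noteq> 0"
    then have "P > 0" unfolding P_def using i0 by (intro sum_pos2[of _ i0]) auto
    moreover have "Q \<ge> 0" by (simp add: Q_def sum_nonneg)
    ultimately show ?thesis by simp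
  next
    assume "q i0 \<noteq> 0"
    then have "Q > 0" unfolding Q_def using i0 by (intro sum_pos2[of _ i0]) auto
    moreover have "P \<ge> 0" by (simp add: P_def sum_nonneg)
    ultimately show ?thesis by simp
  qed
  \<comment> \<open>Symmetry of the bilinear form, evaluated at the two parts, gives \<open>Im l * (P + Q) = 0\<close>.\<close>
  have "(\<Sum>i<n. q i * (\<Sum>j<n. a i j * p j)) = (\<Sum>i<n. \<Sum>j<n. q i * (a i j * p j))"
    by (simp add: sum_distrib_left)
  also have "\<dots> = (\<Sum>j<n. \<Sum>i<n. q i * (a i j * p j))" by (rule sum.swap)
  also have "\<dots> = (\<Sum>j<n. \<Sum>i<n. p j * (a j i * q i))"
    by (intro sum.cong refl) (use sym in auto)
  also have "\<dots> = (\<Sum>i<n. p i * (\<Sum>j<n. a i j * q j))"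
    by (simp add: sum_distrib_left)
  finally have swap: "(\<Sum>i<n. q i * (\<Sum>j<n. a i j * p j)) = (\<Sum>i<n. p i * (\<Sum>j<n. a i j * q j))" .
  have "(\<Sum>i<n. q i * (Re l * p i - Im l * q i)) = (\<Sum>i<n. p i * (Re l * q i + Im l * p i))"
    using swap re im by simp
  then have "(\<Sum>i<n. q i * (Re l * p i - Im l * q i) - p i * (Re l * q i + Im l * p i)) = 0"
    by (simp add: sum_subtractf)
  also have "(\<Sum>i<n. q i * (Re l * p i - Im l * q i) - p i * (Re l * q i + Im l * p i))
      = (\<Sum>i<n. - Im l * ((p i)\<^sup>2 + (q i)\<^sup>2))"
    by (intro sum.cong refl) (simp add: algebra_simps power2_eq_square)
  also have "\<dots> = - Im l * (P + Q)"
    by (simp only: sum_distrib_left[symmetric] sum.distrib P_def Q_def)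
  finally have "Im l = 0" using PQ by auto
  have "Re l * P = (\<Sum>i<n. p i * (\<Sum>j<n. a i j * p j))"
    using re \<open>Im l = 0\<close> by (simp add: P_def sum_distrib_left power2_eq_square ac_simps)
  moreover have "Re l * Q = (\<Sum>i<n. q i * (\<Sum>j<n. a i j * q j))"
    using im \<open>Im l = 0\<close> by (simp add: Q_def sum_distrib_left power2_eq_square ac_simps)
  ultimately have "Re l * (P + Q) \<ge> 0"
    using psd[of p] psd[of q] by (simp add: distrib_left)
  then have "Re l \<ge> 0" using PQ by (simp add: zero_le_mult_iff)
  then have \<rho>: "?\<rho> = Re l" using l \<open>Im l = 0\<close> by (simp add: cmod_def)
  from \<open>p i0 \<noteq> 0 \<or> q i0 \<noteq> 0\<close> show ?thesis
  proof
    assume "p i0 \<noteq> 0"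
    then show ?thesis using that[of p] i0 re \<rho> \<open>Im l = 0\<close> by auto
  next
    assume "q i0 \<noteq> 0"
    then show ?thesis using that[of q] i0 im \<rho> \<open>Im l = 0\<close> by auto
  qed
qed

section \<open>The signless Laplacian as a quadratic form on the vertices\<close>

definition nbrs :: "graph \<Rightarrow> nat \<Rightarrow> nat set" where
  "nbrs G v = {w \<in> verts G. {v, w} \<in> edges G}"

definition Q_op :: "graph \<Rightarrow> (nat \<Rightarrow> real) \<Rightarrow> nat \<Rightarrow> real" where
  "Q_op G f v = real (vdegree G v) * f v + (\<Sum>w\<in>nbrs G v. f w)"

definition Q_form :: "graph \<Rightarrow> (nat \<Rightarrow> real) \<Rightarrow> real" where
  "Q_form G f = (\<Sum>v\<in>verts G. f v * Q_op G f v)"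

lemma finite_verts: "simple_graph G \<Longrightarrow> finite (verts G)"
  by (simp add: simple_graph_def)

lemma nbrs_subset: "nbrs G v \<subseteq> verts G"
  by (auto simp: nbrs_def)

lemma finite_nbrs: "simple_graph G \<Longrightarrow> finite (nbrs G v)"
  using finite_subset[OF nbrs_subset] finite_verts by blast

lemma no_loop: "simple_graph G \<Longrightarrow> {v} \<notin> edges G"
  by (auto simp: simple_graph_def)

lemma self_notin_nbrs: "simple_graph G \<Longrightarrow> v \<notin> nbrs G v"
  using no_loop by (auto simp: nbrs_def)

lemma vdegree_eq_card_nbrs:
  assumes "simple_graph G"
  shows "vdegree G v = card (nbrs G v)"
proof -
  have "inj_on (\<lambda>w. {v, w}) (nbrs G v)"
    by (auto simp: inj_on_def doubleton_eq_iff)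
  moreover have "(\<lambda>w. {v, w}) ` nbrs G v = {e \<in> edges G. v \<in> e}"
  proof (intro equalityI subsetI)
    fix e assume "e \<in> {e \<in> edges G. v \<in> e}"
    then have e: "e \<in> edges G" "v \<in> e" "e \<subseteq> verts G" "card e = 2"
      using assms by (auto simp: simple_graph_def)
    then obtain w where "e = {v, w}"
      by (metis card_2_iff doubleton_eq_iff insertE singletonD)
    with e show "e \<in> (\<lambda>w. {v, w}) ` nbrs G v" by (auto simp: nbrs_def)
  qed (auto simp: nbrs_def)
  ultimately show ?thesis
    unfolding vdegree_def by (metis card_image)
qed

lemma vdegree_less_card:
  assumes "simple_graph G" "v \<in> verts G"
  shows "vdegree G v < card (verts G)"
proof -
  have "nbrs G v \<subset> verts G" using assms nbrs_subset self_notin_nbrs by blast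
  then show ?thesis
    using assms by (simp add: vdegree_eq_card_nbrs finite_verts psubset_card_mono)
qed

text \<open>Double counting: the value at \<open>w\<close> is counted once for every neighbour of \<open>w\<close>.\<close>

lemma sum_over_nbrs:
  fixes g :: "nat \<Rightarrow> real"
  assumes "simple_graph G"
  shows "(\<Sum>v\<in>verts G. \<Sum>w\<in>nbrs G v. g w) = (\<Sum>v\<in>verts G. real (vdegree G v) * g v)"
proof -
  note fin = finite_verts[OF assms]
  have "(\<Sum>v\<in>verts G. \<Sum>w\<in>nbrs G v. g w)
      = (\<Sum>w\<in>verts G. \<Sum>v\<in>{v \<in> verts G. {v, w} \<in> edges G}. g w)"
    unfolding nbrs_def by (rule sum.swap_restrict[OF fin fin])
  also have "\<dots> = (\<Sum>w\<in>verts G. real (vdegree G w) * g w)"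
    by (simp add: vdegree_eq_card_nbrs[OF assms] nbrs_def insert_commute)
  finally show ?thesis .
qed

lemma Q_form_expand:
  "Q_form G f = (\<Sum>v\<in>verts G. real (vdegree G v) * (f v)\<^sup>2) + (\<Sum>v\<in>verts G. \<Sum>w\<in>nbrs G v. f v * f w)"
  unfolding Q_form_def Q_op_def distrib_left sum.distrib sum_distrib_left
  by (simp add: power2_eq_square ac_simps)

text \<open>By the inequality between geometric and arithmetic means on each edge. The lower
  bound makes the signless Laplacian positive semidefinite, the upper one bounds its spectral
  radius by twice the maximum degree.\<close>

lemma adjacency_form_bound:
  assumes "simple_graph G"
  shows "\<bar>\<Sum>v\<in>verts G. \<Sum>w\<in>nbrs G v. f v * f w\<bar> \<le> (\<Sum>v\<in>verts G. real (vdegree G v) * (f v)\<^sup>2)"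
proof -
  let ?D = "\<Sum>v\<in>verts G. real (vdegree G v) * (f v)\<^sup>2"
  have am_gm: "\<bar>f v * f w\<bar> \<le> ((f v)\<^sup>2 + (f w)\<^sup>2) / 2" for v w
  proof -
    have "0 \<le> (\<bar>f v\<bar> - \<bar>f w\<bar>)\<^sup>2" by simp
    then show ?thesis by (simp add: power2_diff abs_mult)
  qed
  have "\<bar>\<Sum>v\<in>verts G. \<Sum>w\<in>nbrs G v. f v * f w\<bar> \<le> (\<Sum>v\<in>verts G. \<bar>\<Sum>w\<in>nbrs G v. f v * f w\<bar>)"
    by (rule sum_abs)
  also have "\<dots> \<le> (\<Sum>v\<in>verts G. \<Sum>w\<in>nbrs G v. \<bar>f v * f w\<bar>)"
    by (intro sum_mono sum_abs)
  also have "\<dots> \<le> (\<Sum>v\<in>verts G. \<Sum>w\<in>nbrs G v. ((f v)\<^sup>2 + (f w)\<^sup>2) / 2)"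
    by (intro sum_mono am_gm)
  also have "\<dots> = (\<Sum>v\<in>verts G. \<Sum>w\<in>nbrs G v. (f v)\<^sup>2 / 2) + (\<Sum>v\<in>verts G. \<Sum>w\<in>nbrs G v. (f w)\<^sup>2 / 2)"
    by (simp add: sum.distrib add_divide_distrib)
  also have "(\<Sum>v\<in>verts G. \<Sum>w\<in>nbrs G v. (f v)\<^sup>2 / 2) = ?D / 2"
    by (simp add: vdegree_eq_card_nbrs[OF assms] sum_divide_distrib)
  also have "(\<Sum>v\<in>verts G. \<Sum>w\<in>nbrs G v. (f w)\<^sup>2 / 2) = ?D / 2"
    by (simp add: sum_over_nbrs[OF assms] sum_divide_distrib)
  finally show ?thesis by simp
qed

lemma Q_form_nonneg: "simple_graph G \<Longrightarrow> Q_form G f \<ge> 0"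
  using adjacency_form_bound[of G f] by (simp add: Q_form_expand)

lemma Q_form_upper:
  assumes "simple_graph G"
  shows "Q_form G f \<le> 2 * (real (card (verts G)) - 1) * (\<Sum>v\<in>verts G. (f v)\<^sup>2)"
proof -
  have "Q_form G f \<le> 2 * (\<Sum>v\<in>verts G. real (vdegree G v) * (f v)\<^sup>2)"
    using adjacency_form_bound[OF assms, of f] by (simp add: Q_form_expand)
  also have "(\<Sum>v\<in>verts G. real (vdegree G v) * (f v)\<^sup>2)
      \<le> (\<Sum>v\<in>verts G. (real (card (verts G)) - 1) * (f v)\<^sup>2)"
  proof (intro sum_mono mult_right_mono)
    fix v assume "v \<in> verts G"
    from vdegree_less_card[OF assms this]
    show "real (vdegree G v) \<le> real (card (verts G)) - 1" by simp
  qed simp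
  finally show ?thesis by (simp only: sum_distrib_left[symmetric] mult.assoc)
qed

definition laplacian_entry :: "graph \<Rightarrow> nat \<Rightarrow> nat \<Rightarrow> real" where
  "laplacian_entry G i j = (if i = j then real (vdegree G (vert G i)) else 0)
     + (if {vert G i, vert G j} \<in> edges G then 1 else 0)"

lemma signless_laplacian_eq_real_mat:
  "signless_laplacian G = real_mat (card (verts G)) (laplacian_entry G)"
  by (rule eq_matI)
    (auto simp: signless_laplacian_def degree_mat_def adjacency_mat_def real_mat_def laplacian_entry_def)

lemma laplacian_entry_sym: "laplacian_entry G i j = laplacian_entry G j i"
  by (auto simp: laplacian_entry_def insert_commute)

lemma bij_betw_vert:
  assumes "simple_graph G"
  shows "bij_betw (vert G) {..<card (verts G)} (verts G)"
  using bij_betw_nth[of "sorted_list_of_set (verts G)" "{..<card (verts G)}" "verts G"]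
    finite_verts[OF assms]
  by (simp add: vert_def[abs_def] fun_eq_iff)

lemma sum_vert:
  assumes "simple_graph G"
  shows "(\<Sum>i<card (verts G). g (vert G i)) = (\<Sum>v\<in>verts G. g v)"
  by (rule sum.reindex_bij_betw[OF bij_betw_vert[OF assms]])

lemma laplacian_row:
  assumes "simple_graph G" "i < card (verts G)"
  shows "(\<Sum>j<card (verts G). laplacian_entry G i j * f (vert G j)) = Q_op G f (vert G i)"
proof -
  let ?n = "card (verts G)"
  have "(\<Sum>j<?n. laplacian_entry G i j * f (vert G j))
     = (\<Sum>j<?n. if i = j then real (vdegree G (vert G i)) * f (vert G i) else 0)
       + (\<Sum>j<?n. if {vert G i, vert G j} \<in> edges G then f (vert G j) else 0)"
    unfolding sum.distrib[symmetric]
    by (intro sum.cong refl) (auto simp: laplacian_entry_def algebra_simps)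
  also have "(\<Sum>j<?n. if {vert G i, vert G j} \<in> edges G then f (vert G j) else 0)
     = (\<Sum>w\<in>verts G. if {vert G i, w} \<in> edges G then f w else 0)"
    by (rule sum_vert[OF assms(1)])
  also have "\<dots> = (\<Sum>w\<in>nbrs G (vert G i). f w)"
    by (simp add: nbrs_def sum.inter_filter finite_verts[OF assms(1)])
  finally show ?thesis using assms(2) by (simp add: Q_op_def)
qed

lemma laplacian_form:
  assumes "simple_graph G"
  shows "(\<Sum>i<card (verts G). f (vert G i) * (\<Sum>j<card (verts G). laplacian_entry G i j * f (vert G j)))
    = Q_form G f"
  using laplacian_row[OF assms, of _ f] sum_vert[OF assms, of "\<lambda>v. f v * Q_op G f v"]
  by (simp add: Q_form_def)

text \<open>Vectors indexed by matrix rows become functions on the vertices, which unlike the row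
  numbers survive the deletion of a vertex.\<close>

lemma transport_to_vertices:
  assumes "simple_graph G"
  obtains f :: "nat \<Rightarrow> real" where "\<And>i. i < card (verts G) \<Longrightarrow> f (vert G i) = x i"
proof
  fix i assume "i < card (verts G)"
  then show "(x \<circ> inv_into {..<card (verts G)} (vert G)) (vert G i) = x i"
    using bij_betw_inv_into_left[OF bij_betw_vert[OF assms]] by simp
qed

lemma Q_form_le_q_radius:
  assumes "simple_graph G" "verts G \<noteq> {}"
  shows "Q_form G f \<le> q_radius G * (\<Sum>v\<in>verts G. (f v)\<^sup>2)"
proof -
  have n: "card (verts G) > 0" using assms finite_verts by (simp add: card_gt_0_iff)
  have "Q_form G f \<le> q_radius G * (\<Sum>i<card (verts G). (f (vert G i))\<^sup>2)"
    using quadratic_form_le_spectral_radius[of "card (verts G)" "laplacian_entry G", OF laplacian_entry_sym n, of "\<lambda>i. f (vert G i)"]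
    by (simp only: laplacian_form[OF assms(1)] q_radius_def signless_laplacian_eq_real_mat)
  then show ?thesis by (simp only: sum_vert[OF assms(1), of "\<lambda>v. (f v)\<^sup>2"])
qed

lemma q_radius_eigenvector:
  assumes "simple_graph G" "verts G \<noteq> {}"
  obtains f where "(\<Sum>v\<in>verts G. (f v)\<^sup>2) = 1"
    and "\<And>v. v \<in> verts G \<Longrightarrow> Q_op G f v = q_radius G * f v"
proof -
  let ?n = "card (verts G)"
  have n: "?n > 0" using assms finite_verts by (simp add: card_gt_0_iff)
  have psd: "(\<Sum>i<?n. x i * (\<Sum>j<?n. laplacian_entry G i j * x j)) \<ge> 0" for x
  proof -
    obtain f where f: "\<And>i. i < ?n \<Longrightarrow> f (vert G i) = x i"
      using transport_to_vertices[OF assms(1)] by blast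
    have "(\<Sum>i<?n. x i * (\<Sum>j<?n. laplacian_entry G i j * x j)) = Q_form G f"
      unfolding laplacian_form[OF assms(1), symmetric] by (intro sum.cong) (simp_all add: f)
    then show ?thesis using Q_form_nonneg[OF assms(1)] by simp
  qed
  obtain x where x: "\<exists>i<?n. x i \<noteq> 0"
    "\<And>i. i < ?n \<Longrightarrow> (\<Sum>j<?n. laplacian_entry G i j * x j) = q_radius G * x i"
    using spectral_radius_real_eigenvector[OF laplacian_entry_sym n psd]
    unfolding q_radius_def signless_laplacian_eq_real_mat by metis
  obtain f where f: "\<And>i. i < ?n \<Longrightarrow> f (vert G i) = x i"
    using transport_to_vertices[OF assms(1)] by blast
  have eig: "Q_op G f v = q_radius G * f v" if "v \<in> verts G" for v
  proof -
    obtain i where i: "i < ?n" "v = vert G i"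
      using bij_betw_vert[OF assms(1)] \<open>v \<in> verts G\<close> by (auto simp: bij_betw_def)
    have "Q_op G f v = (\<Sum>j<?n. laplacian_entry G i j * x j)"
      using laplacian_row[OF assms(1) i(1), of f] i f by simp
    then show ?thesis using x(2)[OF i(1)] i f by simp
  qed
  obtain i where i: "i < ?n" "x i \<noteq> 0" using x by blast
  define X where "X = (\<Sum>v\<in>verts G. (f v)\<^sup>2)"
  have "vert G i \<in> verts G" using i bij_betw_vert[OF assms(1)] by (auto simp: bij_betw_def)
  then have X: "X > 0"
    unfolding X_def using i f finite_verts[OF assms(1)] by (intro sum_pos2[of _ "vert G i"]) auto
  show ?thesis
  proof (rule that[of "\<lambda>v. f v / sqrt X"])
    have "(\<Sum>v\<in>verts G. (f v / sqrt X)\<^sup>2) = X / X"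
      using X by (simp add: power_divide sum_divide_distrib[symmetric]) (simp add: X_def)
    then show "(\<Sum>v\<in>verts G. (f v / sqrt X)\<^sup>2) = 1" using X by simp
    show "Q_op G (\<lambda>v. f v / sqrt X) v = q_radius G * (f v / sqrt X)" if "v \<in> verts G" for v
      using eig[OF that] by (simp add: Q_op_def sum_divide_distrib[symmetric] add_divide_distrib[symmetric])
  qed
qed

lemma Q_form_eigenvector:
  assumes "\<And>v. v \<in> verts G \<Longrightarrow> Q_op G f v = q * f v"
  shows "Q_form G f = q * (\<Sum>v\<in>verts G. (f v)\<^sup>2)"
  using assms by (simp add: Q_form_def sum_distrib_left power2_eq_square ac_simps)

lemma q_radius_nonneg:
  assumes "simple_graph G" "verts G \<noteq> {}" shows "q_radius G \<ge> 0"
proof -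
  obtain f where f: "(\<Sum>v\<in>verts G. (f v)\<^sup>2) = 1" "\<And>v. v \<in> verts G \<Longrightarrow> Q_op G f v = q_radius G * f v"
    using q_radius_eigenvector[OF assms] by blast
  then show ?thesis using Q_form_nonneg[OF assms(1), of f] Q_form_eigenvector[OF f(2)] by simp
qed

lemma q_radius_le:
  assumes "simple_graph G" "verts G \<noteq> {}" shows "q_radius G \<le> 2 * (real (card (verts G)) - 1)"
proof -
  obtain f where f: "(\<Sum>v\<in>verts G. (f v)\<^sup>2) = 1" "\<And>v. v \<in> verts G \<Longrightarrow> Q_op G f v = q_radius G * f v"
    using q_radius_eigenvector[OF assms] by blast
  then show ?thesis using Q_form_upper[OF assms(1), of f] Q_form_eigenvector[OF f(2)] by simp
qed

text \<open>On \<open>n\<close> vertices the entries of the matrix are integers between \<open>0\<close> and \<open>n + 1\<close>, so there are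
  only finitely many matrices, although there are infinitely many graphs. Hence the maximum
  defining \<open>q_max\<close> is an upper bound.\<close>

lemma finite_q_radius_values: "finite (q_radius ` {G. simple_graph G \<and> card (verts G) = n})"
proof -
  define A where "A = real ` {..n + 1}"
  define M where "M = (\<lambda>g. real_mat n (\<lambda>i j. g (i, j))) ` (({..<n} \<times> {..<n}) \<rightarrow>\<^sub>E A)"
  have "finite M" unfolding M_def A_def by (intro finite_imageI finite_PiE) auto
  have "q_radius G \<in> spectral_radius ` M" if G: "simple_graph G" and n: "card (verts G) = n" for G
  proof -
    have entry: "laplacian_entry G i j \<in> A" if "i < n" "j < n" for i j
    proof -
      have "vert G i \<in> verts G" using that n bij_betw_vert[OF G] by (auto simp: bij_betw_def)
      then have "vdegree G (vert G i) < n" using vdegree_less_card[OF G] n by simp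
      define k where "k = (if i = j then vdegree G (vert G i) else 0)
        + (if {vert G i, vert G j} \<in> edges G then 1 else 0)"
      have "laplacian_entry G i j = real k" by (simp add: laplacian_entry_def k_def)
      moreover have "k \<le> n + 1" using \<open>vdegree G (vert G i) < n\<close> by (auto simp: k_def)
      ultimately show ?thesis unfolding A_def by blast
    qed
    have "signless_laplacian G
        = real_mat n (\<lambda>i j. restrict (\<lambda>(i, j). laplacian_entry G i j) ({..<n} \<times> {..<n}) (i, j))"
      unfolding signless_laplacian_eq_real_mat n by (rule eq_matI) (auto simp: real_mat_def)
    moreover have "restrict (\<lambda>(i, j). laplacian_entry G i j) ({..<n} \<times> {..<n}) \<in> ({..<n} \<times> {..<n}) \<rightarrow>\<^sub>E A"
      using entry by auto
    ultimately have "signless_laplacian G \<in> M" unfolding M_def by blast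
    then show ?thesis by (simp add: q_radius_def)
  qed
  then show ?thesis by (intro finite_subset[OF _ finite_imageI[OF \<open>finite M\<close>]]) auto
qed

section \<open>Deleting a vertex\<close>

definition delete_vertex :: "nat \<Rightarrow> graph \<Rightarrow> graph" where
  "delete_vertex z G = (verts G - {z}, {e \<in> edges G. z \<notin> e})"

lemma simple_graph_delete_vertex: "simple_graph G \<Longrightarrow> simple_graph (delete_vertex z G)"
  by (auto simp: simple_graph_def delete_vertex_def)

lemma card_verts_delete_vertex:
  "simple_graph G \<Longrightarrow> z \<in> verts G \<Longrightarrow> card (verts (delete_vertex z G)) = card (verts G) - 1"
  by (simp add: delete_vertex_def finite_verts)

lemma F_free_delete_vertex: "F_free F G \<Longrightarrow> F_free F (delete_vertex z G)"
proof -
  have "subgraph_of S G" if "subgraph_of S (delete_vertex z G)" for S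
    using that unfolding subgraph_of_def delete_vertex_def by auto
  then show "F_free F G \<Longrightarrow> F_free F (delete_vertex z G)"
    unfolding F_free_def by metis
qed

lemma nbrs_delete_vertex: "v \<noteq> z \<Longrightarrow> nbrs (delete_vertex z G) v = nbrs G v - {z}"
  by (auto simp: nbrs_def delete_vertex_def)

lemma Q_op_delete_vertex:
  assumes G: "simple_graph G" and "v \<noteq> z"
  shows "Q_op G f v = Q_op (delete_vertex z G) f v + (if z \<in> nbrs G v then f v + f z else 0)"
proof (cases "z \<in> nbrs G v")
  case True
  have "real (card (nbrs G v)) = real (card (nbrs G v - {z})) + 1"
    using card.remove[OF finite_nbrs[OF G] True] by simp
  moreover have "(\<Sum>w\<in>nbrs G v. f w) = f z + (\<Sum>w\<in>nbrs G v - {z}. f w)"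
    by (rule sum.remove[OF finite_nbrs[OF G] True])
  ultimately show ?thesis
    unfolding Q_op_def vdegree_eq_card_nbrs[OF G] nbrs_delete_vertex[OF assms(2)]
      vdegree_eq_card_nbrs[OF simple_graph_delete_vertex[OF G]]
    using True by (simp only: if_True) (simp only: algebra_simps mult_1)
next
  case False
  then show ?thesis
    unfolding Q_op_def vdegree_eq_card_nbrs[OF G] nbrs_delete_vertex[OF assms(2)]
      vdegree_eq_card_nbrs[OF simple_graph_delete_vertex[OF G]]
    by simp
qed

lemma Q_form_delete_vertex:
  assumes G: "simple_graph G" and z: "z \<in> verts G"
  shows "Q_form G f = Q_form (delete_vertex z G) f
    + (real (vdegree G z) * (f z)\<^sup>2 + 2 * f z * (\<Sum>w\<in>nbrs G z. f w) + (\<Sum>w\<in>nbrs G z. (f w)\<^sup>2))"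
proof -
  have "Q_form G f = f z * Q_op G f z + (\<Sum>v\<in>verts G - {z}. f v * Q_op G f v)"
    unfolding Q_form_def by (rule sum.remove[OF finite_verts[OF G] z])
  also have "(\<Sum>v\<in>verts G - {z}. f v * Q_op G f v)
      = (\<Sum>v\<in>verts G - {z}. f v * Q_op (delete_vertex z G) f v
          + (if v \<in> nbrs G z then (f v)\<^sup>2 + f z * f v else 0))"
    using z by (intro sum.cong refl)
      (auto simp: Q_op_delete_vertex[OF G] nbrs_def insert_commute algebra_simps power2_eq_square)
  also have "\<dots> = Q_form (delete_vertex z G) f
      + (\<Sum>v\<in>verts G - {z}. if v \<in> nbrs G z then (f v)\<^sup>2 + f z * f v else 0)"
    by (simp add: sum.distrib Q_form_def delete_vertex_def)
  also have "(\<Sum>v\<in>verts G - {z}. if v \<in> nbrs G z then (f v)\<^sup>2 + f z * f v else 0)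
      = (\<Sum>v\<in>nbrs G z. (f v)\<^sup>2 + f z * f v)"
    using finite_verts[OF G] nbrs_subset[of G z] self_notin_nbrs[OF G, of z]
    by (intro sum.mono_neutral_cong_right) auto
  finally show ?thesis
    unfolding Q_op_def sum.distrib sum_distrib_left[symmetric]
    by (simp add: algebra_simps power2_eq_square)
qed

text \<open>The deleted vertex \<open>z\<close> is one where the unit eigenvector \<open>f\<close> is smallest in absolute
  value, with \<open>y = (f z)\<^sup>2\<close>. The restriction of \<open>f\<close> to the remaining vertices is a test vector for the
  smaller graph. It loses the edges at \<open>z\<close>, and this loss is small because the squares of \<open>f\<close> over
  the neighbours of \<open>z\<close> sum to 1 minus the contribution of the non-neighbours, each at least \<open>y\<close>.

  A vertex of minimum degree \<open>d\<close> need not be \<open>z\<close>, but it shows that \<open>y\<close> is small: at such a vertex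
  the eigenvalue equation and Cauchy-Schwarz bound the entry of \<open>f\<close>, hence \<open>y\<close>, in terms of \<open>d\<close>.\<close>

lemma delete_light_vertex:
  assumes G: "simple_graph G" and n: "card (verts G) = n" "n \<ge> 2"
    and q: "q = q_radius G" and d: "d = real (min_degree G)"
  obtains z y where "z \<in> verts G" "0 \<le> y" "real n * y \<le> 1"
    "y * (q\<^sup>2 - 2 * q * d + real n * d) \<le> d"
    "q_radius (delete_vertex z G) * (1 - y) \<ge> q - 1 - (2 * q - real n) * y"
proof -
  note fin = finite_verts[OF G]
  have ne: "verts G \<noteq> {}" using n by auto
  obtain f where f1: "(\<Sum>v\<in>verts G. (f v)\<^sup>2) = 1"
    and eig: "\<And>v. v \<in> verts G \<Longrightarrow> Q_op G f v = q * f v"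
    using q_radius_eigenvector[OF G ne] q by blast
  obtain z where z: "z \<in> verts G" and zmin: "\<And>v. v \<in> verts G \<Longrightarrow> (f z)\<^sup>2 \<le> (f v)\<^sup>2"
    using ex_is_arg_min_if_finite[OF fin ne, of "\<lambda>v. (f v)\<^sup>2"]
    by (auto simp: is_arg_min_linorder)
  define y where "y = (f z)\<^sup>2"
  have partial: "(\<Sum>v\<in>nbrs G u. (f v)\<^sup>2) \<le> 1 - (real n - real (vdegree G u)) * y"
    if "u \<in> verts G" for u
  proof -
    have "(real n - real (vdegree G u)) * y = (\<Sum>v\<in>verts G - nbrs G u. y)"
      using vdegree_less_card[OF G that] n finite_nbrs[OF G]
      by (simp add: card_Diff_subset nbrs_subset vdegree_eq_card_nbrs[OF G] of_nat_diff)
    also have "\<dots> \<le> (\<Sum>v\<in>verts G - nbrs G u. (f v)\<^sup>2)"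
      unfolding y_def by (intro sum_mono zmin) auto
    also have "\<dots> = 1 - (\<Sum>v\<in>nbrs G u. (f v)\<^sup>2)"
      using f1 by (simp add: sum_diff fin nbrs_subset)
    finally show ?thesis by simp
  qed
  have nbr_sum: "(\<Sum>w\<in>nbrs G u. f w) = (q - real (vdegree G u)) * f u" if "u \<in> verts G" for u
    using eig[OF that] by (simp add: Q_op_def algebra_simps)
  have "y \<ge> 0" by (simp add: y_def)
  have "(\<Sum>v\<in>verts G. y) \<le> (\<Sum>v\<in>verts G. (f v)\<^sup>2)"
    unfolding y_def by (intro sum_mono zmin)
  then have ny: "real n * y \<le> 1" using f1 n by simp
  have "min_degree G \<in> vdegree G ` verts G"
    unfolding min_degree_def using fin ne by (intro Min_in) auto
  then obtain u where u: "u \<in> verts G" "d = real (vdegree G u)" using d by auto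
  have "(q - d)\<^sup>2 * y \<le> (q - d)\<^sup>2 * (f u)\<^sup>2"
    unfolding y_def using zmin[OF u(1)] by (intro mult_left_mono) auto
  also have "\<dots> = (\<Sum>w\<in>nbrs G u. 1 * f w)\<^sup>2"
    using nbr_sum[OF u(1)] u(2) by (simp add: power_mult_distrib)
  also have "\<dots> \<le> (\<Sum>w\<in>nbrs G u. 1\<^sup>2) * (\<Sum>w\<in>nbrs G u. (f w)\<^sup>2)"
    by (rule Cauchy_Schwarz_ineq_sum)
  also have "\<dots> = d * (\<Sum>w\<in>nbrs G u. (f w)\<^sup>2)"
    using u(2) by (simp add: vdegree_eq_card_nbrs[OF G])
  also have "\<dots> \<le> d * (1 - (real n - d) * y)"
    using partial[OF u(1)] u(2) by (intro mult_left_mono) auto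
  finally have light: "y * (q\<^sup>2 - 2 * q * d + real n * d) \<le> d"
    by (simp add: power2_eq_square algebra_simps)
  let ?H = "delete_vertex z G"
  let ?S = "\<Sum>w\<in>nbrs G z. (f w)\<^sup>2"
  \<comment> \<open>The restriction of \<open>f\<close> as a test vector for the smaller graph.\<close>
  have "verts ?H \<noteq> {}"
    using card_verts_delete_vertex[OF G z] n by auto
  then have "Q_form ?H f \<le> q_radius ?H * (\<Sum>v\<in>verts ?H. (f v)\<^sup>2)"
    by (rule Q_form_le_q_radius[OF simple_graph_delete_vertex[OF G]])
  moreover have "(\<Sum>v\<in>verts ?H. (f v)\<^sup>2) = 1 - y"
    using f1 z fin by (simp add: delete_vertex_def sum_diff1 y_def)
  moreover have "Q_form G f = q"
    using Q_form_eigenvector[OF eig] f1 by simp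
  moreover have "2 * f z * (\<Sum>w\<in>nbrs G z. f w) = 2 * (q - real (vdegree G z)) * y"
    using nbr_sum[OF z] by (simp add: y_def power2_eq_square)
  ultimately have "q - real (vdegree G z) * y - 2 * (q - real (vdegree G z)) * y - ?S
      \<le> q_radius ?H * (1 - y)"
    using Q_form_delete_vertex[OF G z, of f] by (simp add: y_def)
  with partial[OF z] have "q_radius ?H * (1 - y) \<ge> q - 1 - (2 * q - real n) * y"
    by (simp add: algebra_simps)
  from that[OF z \<open>y \<ge> 0\<close> ny light this] show ?thesis .
qed

section \<open>Estimates for one deletion\<close>

text \<open>With \<open>a = q * (q - 2 * d)\<close> the hypothesis reads \<open>y * (a + n * d) \<le> d\<close>, so \<open>n * y\<close> stays
  below 1 by the proportion \<open>a / (a + n * d)\<close>. A small minimum degree makes \<open>q - 2 * d\<close>, and with it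
  \<open>a\<close>, at least of order \<open>\<epsilon>\<close>. The constant \<open>7 / 5\<close> is one for which
  \<open>7 / 5 * (1 - \<epsilon>) \<le> 247 / 100 * (1 - 7 / 5 * \<epsilon>)\<close> holds up to \<open>\<epsilon> = 1 / 2\<close>.\<close>

lemma light_vertex_entry_bound:
  fixes n d q y \<epsilon> :: real
  assumes "n > 0" "0 < \<epsilon>" "\<epsilon> < 1 / 2" "0 \<le> d" "d \<le> (1 - \<epsilon>) * n"
    and q: "q \<ge> 13 / 10 * n" and gap: "q - 2 * d \<ge> 19 / 10 * \<epsilon> * n"
    and y: "y * (q\<^sup>2 - 2 * q * d + n * d) \<le> d"
  shows "n * y \<le> 1 - 7 / 5 * \<epsilon>"
proof (rule ccontr)
  assume "\<not> ?thesis"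
  then have gt: "1 - 7 / 5 * \<epsilon> < n * y" by simp
  define a where "a = q * (q - 2 * d)"
  have "(13 / 10 * n) * (19 / 10 * \<epsilon> * n) \<le> a"
    unfolding a_def using assms by (intro mult_mono) auto
  then have a: "247 / 100 * (\<epsilon> * n\<^sup>2) \<le> a" by (simp add: power2_eq_square ac_simps)
  have pos: "\<epsilon> * n\<^sup>2 > 0" using assms by simp
  have D: "q\<^sup>2 - 2 * q * d + n * d = a + n * d"
    by (simp add: a_def power2_eq_square algebra_simps)
  have nd: "n * d \<le> (1 - \<epsilon>) * n\<^sup>2" "0 \<le> n * d"
    using assms mult_left_mono[of d "(1 - \<epsilon>) * n" n] by (simp_all add: power2_eq_square ac_simps)
  have "(1 - 7 / 5 * \<epsilon>) * (a + n * d) < n * y * (a + n * d)"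
    using gt a pos nd by (intro mult_strict_right_mono) auto
  also have "\<dots> \<le> n * d"
    using mult_left_mono[OF y[unfolded D], of n] \<open>n > 0\<close> by (simp add: mult.assoc)
  finally have "(1 - 7 / 5 * \<epsilon>) * a < 7 / 5 * \<epsilon> * (n * d)"
    by (simp add: algebra_simps)
  also have "\<dots> \<le> 7 / 5 * \<epsilon> * ((1 - \<epsilon>) * n\<^sup>2)"
    using nd assms by (intro mult_left_mono) auto
  finally have "(1 - 7 / 5 * \<epsilon>) * a < 7 / 5 * (1 - \<epsilon>) * (\<epsilon> * n\<^sup>2)" by (simp only: ac_simps)
  moreover have "(1 - 7 / 5 * \<epsilon>) * (247 / 100 * (\<epsilon> * n\<^sup>2)) \<le> (1 - 7 / 5 * \<epsilon>) * a"
    using a assms by (intro mult_left_mono) auto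
  moreover have "7 / 5 * (1 - \<epsilon>) * (\<epsilon> * n\<^sup>2) \<le> (1 - 7 / 5 * \<epsilon>) * (247 / 100) * (\<epsilon> * n\<^sup>2)"
    using assms pos by (intro mult_right_mono) auto
  ultimately show False by (simp only: mult.assoc)
qed

text \<open>For \<open>k = 0\<close> this says that \<open>q / (n - 1)\<close> does not decrease under deletion; an eigenvector
  entry lighter than average by the factor \<open>1 - k\<close> turns this into a definite gain.\<close>

lemma deletion_decrement:
  fixes n q q' y k :: real
  assumes "n > 1" "0 \<le> k" "k \<le> 1" "n * y \<le> 1 - k" "q \<ge> n"
    and q': "q' * (1 - y) \<ge> q - 1 - (2 * q - n) * y"
  shows "q' * (n - 1) \<ge> q * (n - 2) + k * (q - n)"
proof -
  have "(q - q') * (1 - y) \<le> 1 + (q - n) * y" using q' by (simp add: algebra_simps)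
  then have "n * ((q - q') * (1 - y)) \<le> n * (1 + (q - n) * y)"
    using assms by (intro mult_left_mono) auto
  also have "\<dots> = n + (q - n) * (n * y)" by (simp add: algebra_simps)
  also have "\<dots> \<le> n + (q - n) * (1 - k)"
    using assms by (intro add_left_mono mult_left_mono) auto
  finally have scaled: "(q - q') * (n * (1 - y)) \<le> q - k * (q - n)" by (simp add: algebra_simps)
  have "(q - q') * (n - 1) \<le> q - k * (q - n)"
  proof (cases "q - q' \<ge> 0")
    case True
    then have "(q - q') * (n - 1) \<le> (q - q') * (n * (1 - y))"
      using assms by (intro mult_left_mono) (auto simp: algebra_simps)
    with scaled show ?thesis by simp
  next
    case False
    then have "(q - q') * (n - 1) \<le> 0" using assms by (intro mult_nonpos_nonneg) auto
    moreover have "k * (q - n) \<le> 1 * (q - n)" using assms by (intro mult_right_mono) auto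
    ultimately show ?thesis using assms by simp
  qed
  then show ?thesis by (simp add: algebra_simps)
qed

text \<open>Here \<open>q\<close>, \<open>q'\<close> are the radii before and after the deletion and \<open>a\<close>, \<open>a'\<close> the maxima they
  compete with. If \<open>q\<close> is close to the expected \<open>2 * p * m\<close>, the deletion costs at most
  \<open>2 * p + 2 * s + \<epsilon> / 100 - 21 / 50 * \<epsilon>\<close> and the comparison is with the drop of \<open>2 * p - 8 * s - \<epsilon> / 100\<close>
  from \<open>a\<close> to \<open>a'\<close>; it succeeds because \<open>10 * s < 10 / 36 * \<epsilon>\<close>. If \<open>q\<close> is larger, its cost may exceed
  that drop, but monotonicity of \<open>q / (m - 1)\<close> alone keeps \<open>q'\<close> above \<open>a'\<close>.\<close>

lemma excess_survives_deletion:
  fixes m q q' a a' p s \<epsilon> :: real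
  assumes "m > 2" "0 < \<epsilon>" "s < \<epsilon> / 36"
    and gain: "q' * (m - 1) \<ge> q * (m - 2) + 21 / 50 * \<epsilon> * m"
    and "q \<ge> a" and diff: "a' \<le> a - 2 * p + 8 * s + \<epsilon> / 100"
    and upper: "a' \<le> (2 * p + 2 * s + \<epsilon> / 100) * (m - 2)"
  shows "q' > a'"
proof (cases "q \<le> (2 * p + 2 * s + \<epsilon> / 100) * (m - 1)")
  case True
  have "21 / 50 * \<epsilon> * m \<ge> 21 / 50 * \<epsilon> * (m - 1)"
    using assms by (intro mult_left_mono) auto
  moreover have "(q - (2 * p + 2 * s + \<epsilon> / 100) + 21 / 50 * \<epsilon>) * (m - 1)
      = q * (m - 2) + q - (2 * p + 2 * s + \<epsilon> / 100) * (m - 1) + 21 / 50 * \<epsilon> * (m - 1)"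
    by (simp add: field_simps)
  ultimately have "q' * (m - 1) \<ge> (q - (2 * p + 2 * s + \<epsilon> / 100) + 21 / 50 * \<epsilon>) * (m - 1)"
    using gain True by linarith
  then have "q' \<ge> q - (2 * p + 2 * s + \<epsilon> / 100) + 21 / 50 * \<epsilon>"
    using assms by simp
  then show ?thesis using assms by linarith
next
  case False
  let ?u = "2 * p + 2 * s + \<epsilon> / 100"
  have "?u * (m - 2) * (m - 1) < q * (m - 2)"
    using False assms mult_strict_right_mono[of "?u * (m - 1)" q "m - 2"] by (simp add: ac_simps)
  also have "\<dots> \<le> q' * (m - 1)"
    using gain assms by (smt (verit) mult_pos_pos divide_pos_pos)
  finally have "?u * (m - 2) < q'" using assms by (simp add: mult_less_cancel_right)
  with upper show ?thesis by simp
qed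

section \<open>Asymptotics of the Turan numbers\<close>

lemma quadratic_growth:
  fixes e :: "nat \<Rightarrow> real"
  assumes "N > 0" "0 \<le> p" "0 \<le> s"
    and inc: "\<And>n. n \<ge> N \<Longrightarrow> \<bar>e n - e (n - 1) - p * real n\<bar> \<le> s * real n"
  obtains C where "C \<ge> 0"
    "\<And>n. n \<ge> N \<Longrightarrow> (p - s) * (real n)\<^sup>2 / 2 - C * real n \<le> e n"
    "\<And>n. n \<ge> N \<Longrightarrow> e n \<le> (p + s) * (real n)\<^sup>2 / 2 + C * real n"
proof -
  define C where "C = p + s + \<bar>e N - p * (real N)\<^sup>2 / 2\<bar>"
  have "(p - s) * (real n)\<^sup>2 / 2 - C * real n \<le> e n \<and> e n \<le> (p + s) * (real n)\<^sup>2 / 2 + C * real n"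
    if "n \<ge> N" for n
    using that
  proof (induction n rule: dec_induct)
    case base
    have "\<bar>e N - p * (real N)\<^sup>2 / 2\<bar> \<le> C * 1" using assms by (simp add: C_def)
    also have "C * 1 \<le> C * real N" using assms by (intro mult_left_mono) (auto simp: C_def)
    finally have "\<bar>e N - p * (real N)\<^sup>2 / 2\<bar> \<le> C * real N" .
    then have "e N - p * (real N)\<^sup>2 / 2 \<le> C * real N" "- (e N - p * (real N)\<^sup>2 / 2) \<le> C * real N"
      by (auto dest: abs_le_D1 abs_le_D2)
    moreover have "0 \<le> s * (real N)\<^sup>2 / 2" using assms by simp
    moreover have split: "(p - s) * (real N)\<^sup>2 / 2 = p * (real N)\<^sup>2 / 2 - s * (real N)\<^sup>2 / 2"
      "(p + s) * (real N)\<^sup>2 / 2 = p * (real N)\<^sup>2 / 2 + s * (real N)\<^sup>2 / 2"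
      by (simp_all add: field_simps)
    ultimately show ?case unfolding split by auto
  next
    case (step n)
    have "\<bar>e (Suc n) - e n - p * (real n + 1)\<bar> \<le> s * (real n + 1)"
      using inc[of "Suc n"] step by (simp add: add.commute)
    moreover have "C \<ge> (p + s) / 2" "C \<ge> - (p - s) / 2" using assms by (simp_all add: C_def)
    ultimately show ?case
      using step.IH by (simp add: abs_le_iff algebra_simps power2_eq_square add_divide_distrib diff_divide_distrib)
  qed
  moreover have "C \<ge> 0" using assms by (simp add: C_def)
  ultimately show ?thesis using that by blast
qed

text \<open>The increments of \<open>e\<close> determine it up to \<open>s * n\<^sup>2 / 2\<close> and a linear term. The drop from \<open>a m\<close> to
  \<open>a (m - 1)\<close> is then close to \<open>4 * p - 2 * p\<close>: the increment of \<open>e\<close> contributes \<open>4 * p\<close>, the change of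
  the denominator \<open>2 * p\<close>. The errors add up to \<open>8 * s\<close>: \<open>4 * s\<close> from the increment, \<open>2 * s\<close> from the
  size of \<open>e\<close>, and \<open>s\<close> from each of the two approximations of \<open>a\<close>.\<close>

lemma extremal_radius_asymptotics:
  fixes e a :: "nat \<Rightarrow> real"
  assumes "N > 0" "0 \<le> p" "0 \<le> s" "\<tau> > 0"
    and inc: "\<And>n. n \<ge> N \<Longrightarrow> \<bar>e n - e (n - 1) - p * real n\<bar> \<le> s * real n"
    and a: "\<And>n. n \<ge> N \<Longrightarrow> \<bar>a n - 4 * e n / real n\<bar> \<le> s"
  obtains M where "M \<ge> 3"
    "\<And>m. m \<ge> M \<Longrightarrow> a m \<ge> (2 * p - 2 * s - \<tau>) * real m"
    "\<And>m. m \<ge> M \<Longrightarrow> a (m - 1) \<le> a m - 2 * p + 8 * s + \<tau>"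
    "\<And>m. m \<ge> M \<Longrightarrow> a (m - 1) \<le> (2 * p + 2 * s + \<tau>) * (real m - 2)"
proof -
  obtain C where C: "C \<ge> 0"
    and lo: "\<And>n. n \<ge> N \<Longrightarrow> (p - s) * (real n)\<^sup>2 / 2 - C * real n \<le> e n"
    and up: "\<And>n. n \<ge> N \<Longrightarrow> e n \<le> (p + s) * (real n)\<^sup>2 / 2 + C * real n"
    using quadratic_growth[OF assms(1-3) inc] by blast
  have lower: "a n \<ge> 2 * (p - s) * real n - 4 * C - s" if "n \<ge> N" for n
  proof -
    have n: "real n > 0" using that assms by simp
    have "(2 * (p - s) * real n - 4 * C) * real n = 4 * ((p - s) * (real n)\<^sup>2 / 2 - C * real n)"
      by (simp add: field_simps power2_eq_square)
    also have "\<dots> \<le> 4 * e n" using lo[OF that] by simp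
    finally have "(2 * (p - s) * real n - 4 * C) * real n \<le> 4 * e n" .
    then have "2 * (p - s) * real n - 4 * C \<le> 4 * e n / real n"
      using n by (simp add: pos_le_divide_eq)
    then show ?thesis using a[OF that] by linarith
  qed
  have upper: "4 * e n / real n \<le> 2 * (p + s) * real n + 4 * C" if "n \<ge> N" for n
  proof -
    have n: "real n > 0" using that assms by simp
    have "4 * e n \<le> 4 * ((p + s) * (real n)\<^sup>2 / 2 + C * real n)"
      using up[OF that] by simp
    also have "\<dots> = (2 * (p + s) * real n + 4 * C) * real n"
      by (simp add: field_simps power2_eq_square)
    finally have "4 * e n \<le> (2 * (p + s) * real n + 4 * C) * real n" .
    then show ?thesis using n by (simp add: pos_divide_le_eq)
  qed
  obtain K :: nat where K: "(4 * C + s + 2 * (p + s)) / \<tau> \<le> real K"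
    using real_arch_simple by blast
  then have K: "4 * C + s + 2 * (p + s) \<le> \<tau> * real K"
    using assms by (simp add: pos_divide_le_eq mult.commute)
  define M where "M = N + K + 3"
  show ?thesis
  proof (rule that[of M])
    show "M \<ge> 3" by (simp add: M_def)
  next
    fix m assume m: "m \<ge> M"
    then have mN: "m \<ge> N" "m - 1 \<ge> N" and m3: "m \<ge> 3" by (auto simp: M_def)
    have "\<tau> * real K \<le> \<tau> * (real m - 2)"
      using m assms by (intro mult_left_mono) (auto simp: M_def)
    with K have big: "4 * C + s + 2 * (p + s) \<le> \<tau> * (real m - 2)" by simp
    show "a m \<ge> (2 * p - 2 * s - \<tau>) * real m"
      using lower[OF mN(1)] big assms by (simp add: algebra_simps)
    define k where "k = real m - 1"
    have k: "real (m - 1) = k" "real m = k + 1" "k \<ge> 2" using m3 by (auto simp: k_def)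
    have ak: "a (m - 1) \<le> 4 * e (m - 1) / k + s" using a[OF mN(2)] k by simp
    have ek: "4 * e (m - 1) / k \<le> 2 * (p + s) * k + 4 * C" using upper[OF mN(2)] k by simp
    show "a (m - 1) \<le> (2 * p + 2 * s + \<tau>) * (real m - 2)"
      using ak ek big k by (simp add: algebra_simps)
    have "4 * (e (m - 1) + (p - s) * (k + 1)) / (k + 1) \<le> 4 * e m / (k + 1)"
      using inc[OF mN(1)] k by (intro divide_right_mono) (auto simp: algebra_simps abs_le_iff)
    moreover have "4 * (e (m - 1) + (p - s) * (k + 1)) / (k + 1) = 4 * e (m - 1) / (k + 1) + 4 * (p - s)"
      using k by (simp add: field_simps)
    moreover have "4 * e m / (k + 1) \<le> a m + s" using a[OF mN(1)] k by (simp add: abs_le_iff)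
    ultimately have am: "4 * e (m - 1) / (k + 1) + 4 * (p - s) \<le> a m + s" by linarith
    have "4 * e (m - 1) / k - 4 * e (m - 1) / (k + 1) = (4 * e (m - 1) / k) / (k + 1)"
      using k by (simp add: field_simps)
    also have "\<dots> \<le> (2 * (p + s) * k + 4 * C) / (k + 1)"
      using ek k by (intro divide_right_mono) auto
    also have "\<dots> \<le> 2 * (p + s) + \<tau>"
    proof -
      have "4 * C \<le> \<tau> * (k + 1)" using big k assms C by (simp add: algebra_simps)
      then have "2 * (p + s) * k + 4 * C \<le> (2 * (p + s) + \<tau>) * (k + 1)"
        using assms by (simp add: algebra_simps)
      then show ?thesis using k by (simp add: pos_divide_le_eq)
    qed
    finally show "a (m - 1) \<le> a m - 2 * p + 8 * s + \<tau>" using am ak by (simp add: algebra_simps)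
  qed
qed

section \<open>Iterated deletion\<close>

lemma q_radius_le_q_max:
  assumes "G \<in> G_family F \<epsilon> n" shows "q_radius G \<le> q_max F \<epsilon> n"
proof -
  have "q_radius ` G_family F \<epsilon> n \<subseteq> q_radius ` {G. simple_graph G \<and> card (verts G) = n}"
    by (auto simp: G_family_def)
  then have "finite (q_radius ` G_family F \<epsilon> n)"
    using finite_subset finite_q_radius_values by blast
  then show ?thesis unfolding q_max_def using assms by (intro Max_ge) auto
qed

text \<open>The graphs violating the theorem: a graph outside the family that reaches the maximum
  breaks the equality clause even when it does not exceed the maximum.\<close>

definition exceptional :: "graph set \<Rightarrow> real \<Rightarrow> nat \<Rightarrow> graph \<Rightarrow> bool" where
  "exceptional F \<epsilon> n H \<longleftrightarrow> simple_graph H \<and> card (verts H) = n \<and> F_free F H \<and>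
     H \<notin> G_family F \<epsilon> n \<and> q_max F \<epsilon> n \<le> q_radius H"

text \<open>The hypotheses on \<open>q_max\<close> say that it is about \<open>2 * p * m\<close> and drops by about \<open>2 * p\<close>. As the graph
  is outside the family, its minimum degree is at most \<open>(p - \<epsilon>) * m\<close>, which forces a light eigenvector entry. The
  smaller graph strictly exceeds the maximum over its family and therefore cannot belong to it.
  The gain \<open>21 / 50\<close> is \<open>7 / 5 * 3 / 10\<close>, where \<open>q - m \<ge> 3 / 10 * m\<close> comes from \<open>p \<ge> 2 / 3\<close>, that is
  from \<open>r \<ge> 3\<close>.\<close>

lemma exceptional_descends:
  assumes H: "exceptional F \<epsilon> m H" and m: "m \<ge> 3"
    and p: "p = turan_density F" "2 / 3 \<le> p" "p \<le> 1"
    and \<epsilon>: "0 < \<epsilon>" "\<epsilon> < 1 / 2" and s: "s < \<epsilon> / 36"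
    and lower: "q_max F \<epsilon> m \<ge> (2 * p - 2 * s - \<epsilon> / 100) * real m"
    and diff: "q_max F \<epsilon> (m - 1) \<le> q_max F \<epsilon> m - 2 * p + 8 * s + \<epsilon> / 100"
    and upper: "q_max F \<epsilon> (m - 1) \<le> (2 * p + 2 * s + \<epsilon> / 100) * (real m - 2)"
  obtains H' where "exceptional F \<epsilon> (m - 1) H'"
    "q_radius H' * (real m - 1) \<ge> q_radius H * (real m - 2) + 21 / 50 * \<epsilon> * real m"
proof -
  define q where "q = q_radius H"
  define d where "d = real (min_degree H)"
  have G: "simple_graph H" and n: "card (verts H) = m" and free: "F_free F H" and q: "q \<ge> q_max F \<epsilon> m"
    using H by (auto simp: exceptional_def q_def)
  have d: "d \<le> (p - \<epsilon>) * real m" "d \<ge> 0"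
    using H p by (auto simp: exceptional_def G_family_def d_def)
  obtain z y where z: "z \<in> verts H" and y: "0 \<le> y" "real m * y \<le> 1"
    and light: "y * (q\<^sup>2 - 2 * q * d + real m * d) \<le> d"
    and q': "q_radius (delete_vertex z H) * (1 - y) \<ge> q - 1 - (2 * q - real m) * y"
    using delete_light_vertex[OF G n _ q_def d_def] m by auto
  let ?H = "delete_vertex z H"
  have "(2 * p - 2 * s - \<epsilon> / 100) * real m \<ge> 13 / 10 * real m"
    using p \<epsilon> s by (intro mult_right_mono) auto
  with lower q have q13: "q \<ge> 13 / 10 * real m" by simp
  have "19 / 10 * \<epsilon> * real m \<le> ((2 * p - 2 * s - \<epsilon> / 100) - 2 * (p - \<epsilon>)) * real m"
    using \<epsilon> s by (intro mult_right_mono) auto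
  also have "\<dots> \<le> q - 2 * d" using lower q d by (simp add: algebra_simps)
  finally have gap: "q - 2 * d \<ge> 19 / 10 * \<epsilon> * real m" .
  have "(p - \<epsilon>) * real m \<le> (1 - \<epsilon>) * real m" using p by (intro mult_right_mono) auto
  with d have d1: "d \<le> (1 - \<epsilon>) * real m" by simp
  have "real m * y \<le> 1 - 7 / 5 * \<epsilon>"
    using light_vertex_entry_bound[OF _ \<epsilon> d(2) d1 q13 gap light] m by simp
  then have "q_radius ?H * (real m - 1) \<ge> q * (real m - 2) + 7 / 5 * \<epsilon> * (q - real m)"
    using \<epsilon> m q13 q' by (intro deletion_decrement) auto
  moreover have "7 / 5 * \<epsilon> * (3 / 10 * real m) \<le> 7 / 5 * \<epsilon> * (q - real m)"
    using q13 \<epsilon> by (intro mult_left_mono) auto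
  ultimately have gain: "q_radius ?H * (real m - 1) \<ge> q * (real m - 2) + 21 / 50 * \<epsilon> * real m"
    by simp
  have gt: "q_radius ?H > q_max F \<epsilon> (m - 1)"
    using excess_survives_deletion[OF _ \<epsilon>(1) s gain q diff upper] m by simp
  then have "?H \<notin> G_family F \<epsilon> (m - 1)" using q_radius_le_q_max by fastforce
  then have "exceptional F \<epsilon> (m - 1) ?H"
    using gt G n z free by (auto simp: exceptional_def simple_graph_delete_vertex
        card_verts_delete_vertex F_free_delete_vertex)
  with gain show ?thesis using that by (simp add: q_def)
qed

theorem theorem3p1:
  fixes r N :: nat and F :: "graph set" and \<epsilon> \<sigma> :: real
  assumes "r \<ge> 3"
    and "\<forall>K\<in>F. simple_graph K"
    and "turan_density F = 1 - 1 / real r"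
    and "0 < \<epsilon>" and "\<epsilon> < 1 / 2" and "\<sigma> < \<epsilon> / 36"
    and "N > 0"
    and "\<forall>n\<ge>N. G_family F \<epsilon> n \<noteq> {}"
    and "\<forall>n\<ge>N. \<bar>real (ex_num n F) - real (ex_num (n - 1) F) - turan_density F * real n\<bar>
                 \<le> \<sigma> * real n"
    and "\<forall>n\<ge>N. \<bar>q_max F \<epsilon> n - 4 * real (ex_num n F) / real n\<bar> \<le> \<sigma>"
  shows "\<exists>n0. \<forall>n\<ge>n0. \<forall>H. simple_graph H \<and> card (verts H) = n \<and> F_free F H \<longrightarrow>
           q_radius H \<le> q_max F \<epsilon> n \<and>
           (q_radius H = q_max F \<epsilon> n \<longrightarrow> H \<in> G_family F \<epsilon> n)"
proof -
  define p where "p = turan_density F"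
  have p: "2 / 3 \<le> p" "p \<le> 1"
  proof -
    have "1 / real r \<le> 1 / 3" using assms(1) by (simp add: field_simps)
    then show "2 / 3 \<le> p" "p \<le> 1" using assms(3) by (simp_all add: p_def)
  qed
  have \<sigma>: "\<sigma> \<ge> 0"
    using assms(10) by (smt (verit) order_refl)
  obtain M where M: "M \<ge> 3"
    and lower: "\<And>m. m \<ge> M \<Longrightarrow> q_max F \<epsilon> m \<ge> (2 * p - 2 * \<sigma> - \<epsilon> / 100) * real m"
    and diff: "\<And>m. m \<ge> M \<Longrightarrow> q_max F \<epsilon> (m - 1) \<le> q_max F \<epsilon> m - 2 * p + 8 * \<sigma> + \<epsilon> / 100"
    and upper: "\<And>m. m \<ge> M \<Longrightarrow> q_max F \<epsilon> (m - 1) \<le> (2 * p + 2 * \<sigma> + \<epsilon> / 100) * (real m - 2)"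
    using extremal_radius_asymptotics[of N p \<sigma> "\<epsilon> / 100" "\<lambda>n. real (ex_num n F)" "q_max F \<epsilon>"]
      assms(4,7,9,10) p \<sigma> unfolding p_def by auto
  \<comment> \<open>Each step down raises the normalized radius by at least \<open>c / (m - 2)\<close>, and these gains
    dominate the increments of a logarithm; the radius of any graph bounds the total by 2.\<close>
  define c where "c = 21 / 50 * \<epsilon>"
  have c: "c > 0" using assms by (simp add: c_def)
  have density: "q_radius H / (real m - 1) \<le> 2 - c * (ln (real m - 1) - ln (real M - 1))"
    if "m \<ge> M" "exceptional F \<epsilon> m H" for m H
    using that
  proof (induction m arbitrary: H rule: dec_induct)
    case base
    then have H: "simple_graph H" "card (verts H) = M" by (auto simp: exceptional_def)
    then have "verts H \<noteq> {}" using M by auto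
    then have "q_radius H \<le> 2 * (real M - 1)" using q_radius_le[OF H(1)] H(2) by simp
    then show ?case using M by (simp add: pos_divide_le_eq)
  next
    case (step k)
    let ?m = "Suc k"
    have m: "?m \<ge> M" "?m \<ge> 3" "k \<ge> 3" using step M by auto
    obtain H' where H': "exceptional F \<epsilon> (?m - 1) H'"
      "q_radius H' * (real ?m - 1) \<ge> q_radius H * (real ?m - 2) + 21 / 50 * \<epsilon> * real ?m"
      using exceptional_descends[OF step.prems m(2) p_def p assms(4,5,6)
          lower[OF m(1)] diff[OF m(1)] upper[OF m(1)]] by blast
    define x where "x = real k"
    have x: "x \<ge> 3" using m by (simp add: x_def)
    have "q_radius H' * x \<ge> q_radius H * (x - 1) + c * (x + 1)"
      using H'(2) by (simp add: c_def x_def algebra_simps)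
    moreover have "c * x \<le> c * (x + 1)" using c by simp
    ultimately have "q_radius H * (x - 1) + c * x \<le> q_radius H' * x" by linarith
    then have "(q_radius H * (x - 1) + c * x) / (x * (x - 1)) \<le> q_radius H' * x / (x * (x - 1))"
      using x by (intro divide_right_mono) auto
    then have "q_radius H / x + c / (x - 1) \<le> q_radius H' / (x - 1)"
      using x by (simp add: add_divide_distrib)
    moreover have "q_radius H' / (x - 1) \<le> 2 - c * (ln (x - 1) - ln (real M - 1))"
      using step.IH[of H'] H'(1) by (simp add: x_def)
    moreover have "c * (ln x - ln (x - 1)) \<le> c * (1 / (x - 1))"
      using ln_diff_le[of x "x - 1"] x c by (intro mult_left_mono) auto
    ultimately show ?case by (simp add: x_def algebra_simps)
  qed
  obtain n0 :: nat where n0: "exp (2 / c + ln (real M - 1) + 1) + 1 \<le> real n0"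
    using real_arch_simple by blast
  have none: "\<not> exceptional F \<epsilon> n H" if n: "n \<ge> max M n0" for n H
  proof
    assume ex: "exceptional F \<epsilon> n H"
    then have H: "simple_graph H" "card (verts H) = n" by (auto simp: exceptional_def)
    then have "verts H \<noteq> {}" using M n by auto
    then have "q_radius H / (real n - 1) \<ge> 0"
      using q_radius_nonneg[OF H(1)] n M by simp
    with density[OF _ ex] n have "c * (ln (real n - 1) - ln (real M - 1)) \<le> 2" by force
    then have "ln (real n - 1) - ln (real M - 1) \<le> 2 / c"
      using c by (simp add: pos_le_divide_eq mult.commute)
    moreover have "ln (real n - 1) \<ge> 2 / c + ln (real M - 1) + 1"
      using n0 n M by (subst ln_ge_iff) auto
    ultimately show False by simp
  qed
  show ?thesis
  proof (intro exI[of _ "max M n0"] allI impI)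
    fix n H assume n: "max M n0 \<le> n" and H: "simple_graph H \<and> card (verts H) = n \<and> F_free F H"
    show "q_radius H \<le> q_max F \<epsilon> n \<and> (q_radius H = q_max F \<epsilon> n \<longrightarrow> H \<in> G_family F \<epsilon> n)"
    proof (cases "H \<in> G_family F \<epsilon> n")
      case True
      then show ?thesis using q_radius_le_q_max by simp
    next
      case False
      then have "q_radius H < q_max F \<epsilon> n"
        using none[OF n, of H] H by (auto simp: exceptional_def)
      then show ?thesis by simp
    qed
  qed
qed

end
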